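(* Let the port-Hamiltonian system $$E\dot x=(J-R)x+Bu(t),\quad x(0)=x_0,\qquad y=B^\top x,$$ with $E=E^\top\ge0$, $J=-J^\top$, $R=R^\top\ge0$ and regular matrix pencil $\{E,J-R\}$, have at most index $1$. Let $K_E$ be a projector onto $\ker(E)$ and assume that one of the following holds: (a) $K_E^\top R=0$, $K_E^\top B=0$, and the pencil $\{E,J\}$ is regular; or (b) $K_E^\top J=0$, and the pencil $\{E,R\}$ is regular. Consider the energy-conserving subsystem of the $J$-$R$ decomposition, $$\hat E\dot x=Jx,\quad x(0)=x_0,\qquad \hat E=E\ \text{ in case (a)},\qquad \hat E=E_r:=E+K_E^\top K_E\ \text{ in case (b)},$$ which is in case (a) a DAE of at most index $1$ and in case (b) an ODE. Then the implicit midpoint rule $$\tfrac1h\hat E(x_{n+1}-x_n)=\tfrac12J(x_{n+1}+x_n)$$ applied to this subsystem is well-defined for any step size $h\neq0$, i.e., $\hat E\pm\tfrac h2J$ is invertible for any $h\ne0$. It is of second order, and it preserves the energy: $$\mathcal{H}(x_{n+1})=\mathcal{H}(x_n),\qquad \mathcal{H}(x)=\tfrac12x^\top Ex.$$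
   Context: A matrix pencil $\{E,M\}$ is called regular (or non-singular) if the null spaces of $E$ and $M$ intersect trivially. Index means differentiation index. The time grid is equidistant, $t_{n+1}-t_n=h$, with $x_n\approx x(t_n)$. Second order means that the error of the numerical approximation on a compact time interval is $\mathcal{O}(h^2)$ as $h\to0$. *)

theory Defs
  imports "HOL-Analysis.Analysis"
begin

definition sym_pos_semidef :: "real^'n^'n \<Rightarrow> bool" where
  "sym_pos_semidef A \<longleftrightarrow> transpose A = A \<and> (\<forall>x. 0 \<le> x \<bullet> (A *v x))"

definition null_space :: "real^'n^'n \<Rightarrow> (real^'n) set" where
  "null_space A = {x. A *v x = 0}"

definition regular_pencil :: "real^'n^'n \<Rightarrow> real^'n^'n \<Rightarrow> bool" where
  "regular_pencil E M \<longleftrightarrow> null_space E \<inter> null_space M = {0}"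

text \<open>The projector need not be orthogonal.\<close>

definition projector_onto :: "real^'n^'n \<Rightarrow> (real^'n) set \<Rightarrow> bool" where
  "projector_onto K S \<longleftrightarrow> K ** K = K \<and> range ((*v) K) = S"

text \<open>
  Differentiation index of the DAE \<open>E x' = M x + f(t)\<close>, \<open>t \<ge> 0\<close>. Here \<open>F j\<close> is the \<open>j\<close>-th
  derivative of \<open>f\<close>, and \<open>w j\<close> stands for the value of \<open>x\<^sup>(\<^sup>j\<^sup>)\<close> at \<open>t\<close>, treated as an independent
  algebraic variable. The DAE together with its first \<open>k\<close> derivatives is the derivative array
  \<open>E x\<^sup>(\<^sup>j\<^sup>+\<^sup>1\<^sup>) = M x\<^sup>(\<^sup>j\<^sup>) + f\<^sup>(\<^sup>j\<^sup>)(t)\<close>, \<open>j \<le> k\<close>; the index is the least \<open>k\<close> for which the array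
  determines \<open>x'\<close> as a function \<open>\<phi>\<close> of \<open>t\<close> and \<open>x\<close>, and \<open>\<infinity>\<close> if there is no such \<open>k\<close>.
\<close>

definition derivative_array_determines ::
    "real^'n^'n \<Rightarrow> real^'n^'n \<Rightarrow> (real \<Rightarrow> real^'n) \<Rightarrow> nat \<Rightarrow> bool" where
  "derivative_array_determines E M f k \<longleftrightarrow>
     (\<exists>F :: nat \<Rightarrow> real \<Rightarrow> real^'n. \<exists>\<phi> :: real \<Rightarrow> real^'n \<Rightarrow> real^'n.
        (\<forall>t\<ge>0. F 0 t = f t) \<and>
        (\<forall>j<k. \<forall>t\<ge>0. (F j has_vector_derivative F (Suc j) t) (at t within {0..})) \<and>
        (\<forall>t\<ge>0. \<forall>w :: nat \<Rightarrow> real^'n.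
           (\<forall>j\<le>k. E *v w (Suc j) = M *v w j + F j t) \<longrightarrow> w 1 = \<phi> t (w 0)))"

definition differentiation_index ::
    "real^'n^'n \<Rightarrow> real^'n^'n \<Rightarrow> (real \<Rightarrow> real^'n) \<Rightarrow> enat" where
  "differentiation_index E M f = (INF k\<in>{k. derivative_array_determines E M f k}. enat k)"

definition case_a :: "real^'n^'n \<Rightarrow> real^'n^'n \<Rightarrow> real^'n^'n \<Rightarrow> real^'m^'n \<Rightarrow> real^'n^'n \<Rightarrow> bool" where
  "case_a E J R B K \<longleftrightarrow> transpose K ** R = 0 \<and> transpose K ** B = 0 \<and> regular_pencil E J"

definition case_b :: "real^'n^'n \<Rightarrow> real^'n^'n \<Rightarrow> real^'n^'n \<Rightarrow> real^'n^'n \<Rightarrow> bool" where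
  "case_b E J R K \<longleftrightarrow> transpose K ** J = 0 \<and> regular_pencil E R"

definition hamiltonian :: "real^'n^'n \<Rightarrow> real^'n \<Rightarrow> real" where
  "hamiltonian E x = 1/2 * (x \<bullet> (E *v x))"

text \<open>Solution of \<open>E x' = M x\<close>, \<open>x(0) = x0\<close>, on the time interval \<open>[0,T]\<close>.\<close>

definition dae_solution ::
    "real^'n^'n \<Rightarrow> real^'n^'n \<Rightarrow> real^'n \<Rightarrow> real \<Rightarrow> (real \<Rightarrow> real^'n) \<Rightarrow> bool" where
  "dae_solution E M x0 T x \<longleftrightarrow> x 0 = x0 \<and>
     (\<forall>t\<in>{0..T}. \<exists>x'. (x has_vector_derivative x') (at t within {0..T}) \<and> E *v x' = M *v x t)"

text \<open>One step of size \<open>h\<close> of the implicit midpoint rule for \<open>E x' = M x\<close>, from \<open>x\<close> to \<open>y\<close>.\<close>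

definition midpoint_step ::
    "real^'n^'n \<Rightarrow> real^'n^'n \<Rightarrow> real \<Rightarrow> real^'n \<Rightarrow> real^'n \<Rightarrow> bool" where
  "midpoint_step E M h x y \<longleftrightarrow> (1/h) *\<^sub>R (E *v (y - x)) = (1/2) *\<^sub>R (M *v (y + x))"

text \<open>
  On every interval \<open>[0,T]\<close> the error at the grid points \<open>n h\<close> is \<open>O(h^p)\<close> as \<open>h \<rightarrow> 0\<close>, uniformly
  in \<open>n\<close>. The error refers to an exact solution starting at \<open>x0\<close>; for a genuine DAE this means that
  \<open>x0\<close> is a consistent initial value.
\<close>

definition midpoint_has_order ::
    "nat \<Rightarrow> real^'n^'n \<Rightarrow> real^'n^'n \<Rightarrow> real^'n \<Rightarrow> bool" where
  "midpoint_has_order p E M x0 \<longleftrightarrow>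
     (\<forall>T>0. \<forall>x. dae_solution E M x0 T x \<longrightarrow>
        (\<exists>C. \<forall>\<^sub>F h in at_right 0. \<forall>xs :: nat \<Rightarrow> real^'n.
           xs 0 = x0 \<and> (\<forall>n. midpoint_step E M h (xs n) (xs (Suc n))) \<longrightarrow>
           (\<forall>n. real n * h \<le> T \<longrightarrow> norm (xs n - x (real n * h)) \<le> C * h ^ p)))"

end

theory Submission
  imports Defs
begin

text \<open>
  Index at most one is used in a purely algebraic form: no nonzero \<open>v\<close> with \<open>E v = 0\<close> has \<open>M v\<close> in
  the range of \<open>E\<close>. Differentiating \<open>E x' = M x\<close> once gives \<open>E x'' = M x'\<close>, and such a \<open>v\<close> is exactly
  an ambiguity in \<open>x'\<close> that these two equations leave. When the index is higher, it is resolved only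
  by constraints that stay hidden until further differentiation, whence the names below. The assumed index bound concerns \<open>E\<close>, \<open>J - R\<close>
  and an inhomogeneity; it yields the algebraic condition only because the derivative array has a
  solution to perturb, and a solution exists because \<open>E - (J - R)\<close> is invertible
  (\<open>index_le_1_imp_no_hidden_constraint\<close>). In case (a) the matrices \<open>J - R\<close> and \<open>J\<close> agree on the kernel
  of \<open>E\<close>, so the condition passes to the pair \<open>E\<close>, \<open>J\<close>. In case (b) the matrix \<open>E + K\<^sup>T K\<close> is
  positive definite, so its kernel contains no such \<open>v\<close>.

  Invertibility of \<open>Ehat \<plusminus> (h/2) J\<close>: if \<open>x\<close> is in the kernel, the inner product with \<open>x\<close> removes
  \<open>J\<close> and leaves \<open>x \<bullet> Ehat x = 0\<close>. Semidefiniteness gives \<open>Ehat x = 0\<close>, hence \<open>J x = 0\<close>, and \<open>Ehat\<close>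
  and \<open>J\<close> have no common null vector except \<open>0\<close>.

  Second order is obtained for every pair \<open>E\<close>, \<open>M\<close> satisfying the algebraic condition
  (\<open>midpoint_order_2_of_no_hidden_constraint\<close>). The condition says that \<open>E\<close> is injective on the
  subspace \<open>V = {v. M v \<in> range E}\<close>. Exact solutions stay in \<open>V\<close>, and so do midpoint iterates that
  start there. With a linear left inverse \<open>G\<close> of \<open>E\<close> on \<open>V\<close>, both therefore obey the ordinary
  differential equation \<open>x' = G M x\<close>, the exact solution literally and the iterates in the sense of the
  midpoint rule. There the classical argument applies: a defect of size \<open>h\<^sup>3\<close> in each step, and a
  discrete Gronwall estimate over \<open>T/h\<close> steps.

  Energy: the inner product of the step equation with \<open>x\<^sub>n\<^sub>+\<^sub>1 + x\<^sub>n\<close> removes \<open>J\<close> and telescopes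
  \<open>x \<bullet> E x\<close>. In case (b) the energy is still measured with \<open>E\<close>, not with \<open>E + K\<^sup>T K\<close>. This is
  consistent because multiplying the step equation by \<open>K\<^sup>T\<close> shows that the added term does not
  contribute to the step (\<open>regularized_step_is_step\<close>).
\<close>

section \<open>Symmetric, skew-symmetric and semidefinite matrices\<close>

lemma inner_matrix_vector_transpose:
  fixes A :: "real^'n^'m"
  shows "x \<bullet> (A *v y) = (transpose A *v x) \<bullet> y"
  by (simp add: dot_lmul_matrix)

lemma transpose_mult_eq_0:
  fixes A B :: "real^'n^'n"
  assumes "transpose A ** B = 0"
  shows "transpose B ** A = 0"
proof -
  have "transpose B ** A = transpose (transpose A ** B)"
    by (simp add: matrix_transpose_mul)
  also have "\<dots> = 0" unfolding assms by (simp add: transpose_def vec_eq_iff)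
  finally show ?thesis .
qed

lemma inner_skew_eq_0:
  fixes J :: "real^'n^'n"
  assumes "transpose J = - J"
  shows "x \<bullet> (J *v x) = 0"
proof -
  have "x \<bullet> (J *v x) = (transpose J *v x) \<bullet> x"
    by (rule inner_matrix_vector_transpose)
  also have "\<dots> = - (x \<bullet> (J *v x))"
    using matrix_vector_mult_diff_rdistrib[of 0 J x] by (simp add: assms inner_commute)
  finally show ?thesis by simp
qed

text \<open>
  A zero of a nonnegative quadratic form is a minimum, so the gradient \<open>2 A x\<close> vanishes there. The
  proof moves from \<open>x\<close> a small step \<open>s\<close> against \<open>y = A x\<close>: if \<open>y \<noteq> 0\<close>, the term linear in \<open>s\<close> wins and
  the form becomes negative.
\<close>

lemma psd_null_if_form_0:
  fixes A :: "real^'n^'n"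
  assumes "sym_pos_semidef A" and "x \<bullet> (A *v x) = 0"
  shows "A *v x = 0"
proof (rule ccontr)
  assume "A *v x \<noteq> 0"
  define y where "y = A *v x"
  define c where "c = y \<bullet> (A *v y)"
  have y: "y \<bullet> y > 0" using \<open>A *v x \<noteq> 0\<close> by (simp add: y_def)
  have c: "c \<ge> 0" using assms(1) by (simp add: sym_pos_semidef_def c_def)
  have xAy: "x \<bullet> (A *v y) = y \<bullet> y"
    using assms(1) by (simp add: inner_matrix_vector_transpose sym_pos_semidef_def y_def)
  have form: "0 \<le> - 2 * s * (y \<bullet> y) + s\<^sup>2 * c" for s
  proof -
    have "0 \<le> (x - s *\<^sub>R y) \<bullet> (A *v (x - s *\<^sub>R y))"
      using assms(1) by (simp add: sym_pos_semidef_def)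
    also have "\<dots> = x \<bullet> (A *v x) - s * (x \<bullet> (A *v y)) - s * (y \<bullet> (A *v x)) + s\<^sup>2 * c"
      by (simp add: c_def matrix_vector_mult_diff_distrib matrix_vector_mult_scaleR
          inner_diff_left inner_diff_right power2_eq_square algebra_simps)
    also have "\<dots> = - 2 * s * (y \<bullet> y) + s\<^sup>2 * c"
      using xAy assms(2) by (simp add: y_def)
    finally show ?thesis .
  qed
  \<comment> \<open>Any \<open>s > 0\<close> with \<open>s c < 2 (y \<bullet> y)\<close> works; the \<open>+ 1\<close> covers \<open>c = 0\<close>.\<close>
  define s where "s = (y \<bullet> y) / (c + 1)"
  have "s > 0" using y c by (simp add: s_def)
  have "s * c < 2 * (y \<bullet> y)"
    using y c by (simp add: s_def field_simps add_pos_nonneg add_strict_increasing)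
  then have "s * (s * c) < s * (2 * (y \<bullet> y))"
    using \<open>s > 0\<close> by (rule mult_strict_left_mono)
  with form[of s] show False by (simp add: power2_eq_square algebra_simps)
qed

lemma invertible_if_trivial_null:
  fixes A :: "real^'n^'n"
  assumes "\<And>x. A *v x = 0 \<Longrightarrow> x = 0"
  shows "invertible A"
  using assms by (simp add: invertible_left_inverse matrix_left_invertible_ker)

text \<open>Testing with \<open>x\<close> itself separates the two summands, since the skew part has zero quadratic form.\<close>

lemma psd_plus_skew_invertible:
  fixes E J :: "real^'n^'n"
  assumes E: "sym_pos_semidef E" and J: "transpose J = - J"
    and reg: "regular_pencil E J" and "c \<noteq> 0"
  shows "invertible (E + c *\<^sub>R J)"
proof (rule invertible_if_trivial_null)
  fix x assume 0: "(E + c *\<^sub>R J) *v x = 0"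
  then have *: "E *v x + c *\<^sub>R (J *v x) = 0"
    by (simp add: matrix_vector_mult_add_rdistrib scaleR_matrix_vector_assoc)
  then have "x \<bullet> (E *v x + c *\<^sub>R (J *v x)) = 0" by simp
  then have "x \<bullet> (E *v x) = 0"
    by (simp add: inner_add_right inner_skew_eq_0[OF J])
  then have "E *v x = 0" by (rule psd_null_if_form_0[OF E])
  moreover from this * \<open>c \<noteq> 0\<close> have "J *v x = 0" by simp
  ultimately show "x = 0" using reg by (auto simp: regular_pencil_def null_space_def)
qed

text \<open>
  For a dissipative pencil, the absence of a common null vector already implies that
  \<open>\<lambda> E - (J - R)\<close> is invertible for \<open>\<lambda> > 0\<close>. The value \<open>\<lambda> = 1\<close> is enough to solve the derivative
  array below.
\<close>

lemma dissipative_pencil_invertible: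
  fixes E J R :: "real^'n^'n"
  assumes E: "sym_pos_semidef E" and J: "transpose J = - J" and R: "sym_pos_semidef R"
    and reg: "regular_pencil E (J - R)"
  shows "invertible (E - (J - R))"
proof (rule invertible_if_trivial_null)
  fix x assume "(E - (J - R)) *v x = 0"
  then have *: "E *v x - (J *v x - R *v x) = 0"
    by (simp add: matrix_vector_mult_diff_rdistrib)
  then have "x \<bullet> (E *v x - (J *v x - R *v x)) = 0" by simp
  then have "x \<bullet> (E *v x) + x \<bullet> (R *v x) = 0"
    by (simp add: inner_diff_right inner_skew_eq_0[OF J])
  moreover have "x \<bullet> (E *v x) \<ge> 0" "x \<bullet> (R *v x) \<ge> 0"
    using E R by (auto simp: sym_pos_semidef_def)
  ultimately have "x \<bullet> (E *v x) = 0" by linarith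
  then have "E *v x = 0" by (rule psd_null_if_form_0[OF E])
  moreover from this * have "(J - R) *v x = 0" by (simp add: matrix_vector_mult_diff_rdistrib)
  ultimately show "x = 0" using reg by (auto simp: regular_pencil_def null_space_def)
qed

section \<open>Index at most one\<close>

text \<open>
  The solution is sought in the form \<open>w\<^sub>j = a + j d\<close>. With \<open>P = E - M\<close> the two equations become
  \<open>P a + E d = f0\<close> and \<open>P (a + d) + E d = f1\<close>; their difference \<open>P d = f1 - f0\<close> determines \<open>d\<close>, and
  then the first one determines \<open>a\<close>.
\<close>

lemma derivative_array_solvable:
  fixes E M :: "real^'n^'n"
  assumes "invertible (E - M)"
  obtains w :: "nat \<Rightarrow> real^'n"
  where "E *v w 1 = M *v w 0 + f0" and "E *v w 2 = M *v w 1 + f1"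
proof -
  obtain P where P: "(E - M) ** P = mat 1"
    using assms invertible_def by blast
  have inv: "E *v (P *v z) = z + M *v (P *v z)" for z
    using arg_cong[OF P, of "\<lambda>A. A *v z"]
    by (simp add: matrix_vector_mul_assoc[symmetric] matrix_vector_mult_diff_rdistrib algebra_simps)
  define d where "d = P *v (f1 - f0)"
  define a where "a = P *v (f0 - E *v d)"
  have d: "E *v d = f1 - f0 + M *v d" unfolding d_def by (rule inv)
  have a: "E *v a = f0 - E *v d + M *v a" unfolding a_def by (rule inv)
  show ?thesis
  proof (rule that[of "\<lambda>j. a + real j *\<^sub>R d"])
    show "E *v (a + real 1 *\<^sub>R d) = M *v (a + real 0 *\<^sub>R d) + f0"
      using a by (simp add: matrix_vector_right_distrib)
    show "E *v (a + real 2 *\<^sub>R d) = M *v (a + real 1 *\<^sub>R d) + f1"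
    proof -
      have "a + real 2 *\<^sub>R d = (a + d) + d"
        using scaleR_2[of d] by (simp add: add.assoc)
      then have "E *v (a + real 2 *\<^sub>R d) = (E *v a + E *v d) + E *v d"
        by (simp only: matrix_vector_right_distrib)
      also have "E *v a + E *v d = f0 + M *v a" using a by simp
      also have "f0 + M *v a + E *v d = f0 + M *v a + (f1 - f0 + M *v d)"
        by (rule arg_cong[OF d])
      also have "\<dots> = M *v (a + real 1 *\<^sub>R d) + f1"
        by (simp add: matrix_vector_right_distrib)
      finally show ?thesis .
    qed
  qed
qed

text \<open>
  Adding \<open>v\<close> to \<open>w\<^sub>1\<close> and \<open>z\<close> to \<open>w\<^sub>2\<close> turns a solution of the derivative array into another one with
  the same \<open>w\<^sub>0\<close>, so that determinacy of \<open>w\<^sub>1\<close> forces \<open>v = 0\<close>. The argument needs one solution to start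
  from: over an inconsistent array, the defining condition of the index would hold vacuously.
\<close>

lemma index_le_1_imp_no_hidden_constraint:
  fixes E M :: "real^'n^'n"
  assumes ind: "differentiation_index E M f \<le> 1" and inv: "invertible (E - M)"
    and v: "E *v v = 0" and z: "M *v v = E *v z"
  shows "v = 0"
proof -
  have "(INF k\<in>{k. derivative_array_determines E M f k}. enat k) < enat 2"
    using ind by (auto simp: differentiation_index_def one_enat_def intro: order_le_less_trans)
  then obtain k where k: "derivative_array_determines E M f k" "k \<le> 1"
    by (auto simp: INF_less_iff)
  from k(1)[unfolded derivative_array_determines_def] show ?thesis
  proof (elim exE conjE)
    fix F :: "nat \<Rightarrow> real \<Rightarrow> real^'n" and \<phi>
    assume "\<forall>t\<ge>0. \<forall>w :: nat \<Rightarrow> real^'n.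
       (\<forall>j\<le>k. E *v w (Suc j) = M *v w j + F j t) \<longrightarrow> w 1 = \<phi> t (w 0)"
    then have det: "w 1 = \<phi> 0 (w 0)" if "\<forall>j\<le>k. E *v w (Suc j) = M *v w j + F j 0"
      for w :: "nat \<Rightarrow> real^'n" using that by blast
    obtain w :: "nat \<Rightarrow> real^'n" where w: "E *v w 1 = M *v w 0 + F 0 0" "E *v w 2 = M *v w 1 + F 1 0"
      using derivative_array_solvable[OF inv, of "F 0 0" "F 1 0"] .
    define w' where "w' = (\<lambda>j::nat. w j + (if j = 1 then v else if j = 2 then z else 0))"
    have le1: "j \<le> k \<Longrightarrow> j = 0 \<or> j = 1" for j using k(2) by linarith
    have w_array: "E *v w (Suc j) = M *v w j + F j 0" if "j \<le> k" for j
      using le1[OF that] w by (auto simp: numeral_2_eq_2)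
    have w'_array: "E *v w' (Suc j) = M *v w' j + F j 0" if "j \<le> k" for j
      using le1[OF that]
    proof
      assume "j = 0"
      then show ?thesis using w(1) v by (simp add: w'_def matrix_vector_right_distrib)
    next
      assume "j = 1"
      then show ?thesis using w(2) z
        by (simp add: w'_def matrix_vector_right_distrib numeral_2_eq_2)
    qed
    have "w 1 = \<phi> 0 (w 0)" using det w_array by blast
    moreover have "w' 1 = \<phi> 0 (w' 0)" using det w'_array by blast
    moreover have "w' 0 = w 0" "w' 1 = w 1 + v" by (auto simp: w'_def)
    ultimately show ?thesis by simp
  qed
qed

lemma no_hidden_constraint_imp_index_le_1:
  fixes E M :: "real^'n^'n"
  assumes "\<And>v z. E *v v = 0 \<Longrightarrow> M *v v = E *v z \<Longrightarrow> v = 0"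
  shows "differentiation_index E M (\<lambda>t. 0) \<le> 1"
proof -
  \<comment> \<open>Any \<open>b\<close> that extends \<open>a\<close> to a solution of the array will do: the hypothesis makes it unique.\<close>
  define \<phi> where "\<phi> = (\<lambda>(t::real) a. SOME b. E *v b = M *v a \<and> (\<exists>c. E *v c = M *v b))"
  have "w 1 = \<phi> t (w 0)" if w: "\<forall>j\<le>1. E *v w (Suc j) = M *v w j + 0" for w :: "nat \<Rightarrow> real^'n" and t
  proof -
    have w1: "E *v w 1 = M *v w 0" and w2: "E *v w 2 = M *v w 1"
      using w[rule_format, of 0] w[rule_format, of 1] by (simp_all add: numeral_2_eq_2)
    have "E *v \<phi> t (w 0) = M *v w 0 \<and> (\<exists>c. E *v c = M *v \<phi> t (w 0))"
      unfolding \<phi>_def by (rule someI[of _ "w 1"]) (use w1 w2 in blast)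
    then obtain c where c: "E *v \<phi> t (w 0) = M *v w 0" "E *v c = M *v \<phi> t (w 0)" by blast
    have "w 1 - \<phi> t (w 0) = 0"
      by (rule assms[where z = "w 2 - c"])
         (simp_all add: matrix_vector_mult_diff_distrib w1 w2 c del: One_nat_def)
    then show ?thesis by simp
  qed
  then have "derivative_array_determines E M (\<lambda>t. 0) 1"
    unfolding derivative_array_determines_def
    by (intro exI[of _ "\<lambda>_ _. 0"] exI[of _ \<phi>]) auto
  then show ?thesis
    unfolding differentiation_index_def one_enat_def by (intro INF_lower) simp
qed

section \<open>The midpoint step as a linear system\<close>

lemma midpoint_step_increment:
  fixes E M :: "real^'n^'n"
  assumes h: "h \<noteq> 0"
  shows "midpoint_step E M h x y \<longleftrightarrow> E *v (y - x) = (h/2) *\<^sub>R (M *v (y + x))"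
proof
  assume "midpoint_step E M h x y"
  then have "h *\<^sub>R ((1/h) *\<^sub>R (E *v (y - x))) = h *\<^sub>R ((1/2) *\<^sub>R (M *v (y + x)))"
    by (simp only: midpoint_step_def)
  then show "E *v (y - x) = (h/2) *\<^sub>R (M *v (y + x))" using h by simp
next
  assume eq: "E *v (y - x) = (h/2) *\<^sub>R (M *v (y + x))"
  show "midpoint_step E M h x y" unfolding midpoint_step_def eq using h by simp
qed

lemma midpoint_step_iff:
  fixes E M :: "real^'n^'n"
  assumes "h \<noteq> 0"
  shows "midpoint_step E M h x y \<longleftrightarrow> (E - (h/2) *\<^sub>R M) *v y = (E + (h/2) *\<^sub>R M) *v x"
proof -
  have "E *v (y - x) = (h/2) *\<^sub>R (M *v (y + x)) \<longleftrightarrow>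
      E *v y - E *v x = (h/2) *\<^sub>R (M *v y) + (h/2) *\<^sub>R (M *v x)"
    by (simp only: matrix_vector_mult_diff_distrib matrix_vector_right_distrib scaleR_add_right)
  also have "\<dots> \<longleftrightarrow> E *v y - (h/2) *\<^sub>R (M *v y) = E *v x + (h/2) *\<^sub>R (M *v x)"
    by (auto simp: algebra_simps)
  also have "\<dots> \<longleftrightarrow> (E - (h/2) *\<^sub>R M) *v y = (E + (h/2) *\<^sub>R M) *v x"
    by (simp only: matrix_vector_mult_add_rdistrib matrix_vector_mult_diff_rdistrib
        scaleR_matrix_vector_assoc)
  finally show ?thesis by (simp only: midpoint_step_increment[OF assms])
qed

lemma ex1_matrix_vector_eq:
  fixes A :: "real^'n^'n"
  assumes "invertible A"
  shows "\<exists>!y. A *v y = z"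
proof -
  obtain A' where A': "A ** A' = mat 1" "A' ** A = mat 1" using assms by (auto simp: invertible_def)
  show ?thesis
  proof (rule ex1I[of _ "A' *v z"])
    show "A *v (A' *v z) = z" by (simp add: matrix_vector_mul_assoc A')
    show "y = A' *v z" if "A *v y = z" for y
      using that by (auto simp: matrix_vector_mul_assoc A')
  qed
qed

section \<open>The implicit midpoint rule for a linear ordinary differential equation\<close>

lemma norm_diff_le_of_derivative_bound:
  fixes g :: "real \<Rightarrow> 'a::real_normed_vector"
  assumes "\<And>s. s \<in> {0..h} \<Longrightarrow> (g has_vector_derivative g' s) (at s within {0..h})"
    and "\<And>s. s \<in> {0..h} \<Longrightarrow> norm (g' s) \<le> c" and "s \<in> {0..h}"
  shows "norm (g s - g 0) \<le> c * h"
proof -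
  have "0 \<le> c" using assms(2)[OF assms(3)] norm_ge_zero order_trans by blast
  have "norm (g s - g 0) \<le> c * norm (s - 0)"
  proof (rule differentiable_bound[of "{0..h}" g "\<lambda>r d. d *\<^sub>R g' r"])
    fix r assume r: "r \<in> {0..h}"
    then show "(g has_derivative (\<lambda>d. d *\<^sub>R g' r)) (at r within {0..h})"
      using assms(1) by (simp add: has_vector_derivative_def)
    show "onorm (\<lambda>d. d *\<^sub>R g' r) \<le> c"
    proof (rule onorm_le)
      fix d :: real
      show "norm (d *\<^sub>R g' r) \<le> c * norm d"
        using mult_left_mono[OF assms(2)[OF r], of "\<bar>d\<bar>"] by (simp add: mult.commute)
    qed
  qed (use assms(3) in auto)
  also have "\<dots> \<le> c * h" using \<open>0 \<le> c\<close> assms(3) by (auto intro: mult_left_mono)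
  finally show ?thesis .
qed

text \<open>
  As a function \<open>g\<close> of the step size, the defect satisfies \<open>g(0) = g'(0) = 0\<close>, and
  \<open>g''(s) = - (s/2) A\<^sup>3 x(t + s)\<close>: the lower-order terms cancel because the rule is symmetric. The
  mean value inequality, applied first to \<open>g'\<close> and then to \<open>g\<close>, gives the cubic bound.
\<close>

lemma trapezoidal_defect:
  fixes x :: "real \<Rightarrow> 'a::real_normed_vector"
  assumes A: "bounded_linear A"
    and x: "\<And>s. s \<in> {0..T} \<Longrightarrow> (x has_vector_derivative A (x s)) (at s within {0..T})"
    and b: "\<And>s. s \<in> {0..T} \<Longrightarrow> norm (A (A (A (x s)))) \<le> b"
    and t: "0 \<le> t" and h: "0 \<le> h" "t + h \<le> T"
  shows "norm (x (t + h) - x t - (h/2) *\<^sub>R A (x (t + h) + x t)) \<le> b * h ^ 3"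
proof -
  interpret A: bounded_linear A by (rule A)
  define X where "X = (\<lambda>s. x (t + s))"
  have mem: "t + s \<in> {0..T}" if "s \<in> {0..h}" for s using that t h by auto
  have X: "(X has_vector_derivative A (X s)) (at s within {0..h})" if "s \<in> {0..h}" for s
  proof -
    have "((x \<circ> (\<lambda>s. t + s)) has_vector_derivative (1 *\<^sub>R A (x (t + s)))) (at s within {0..h})"
    proof (rule vector_diff_chain_within)
      show "((\<lambda>s. t + s) has_vector_derivative 1) (at s within {0..h})"
        by (auto intro!: derivative_eq_intros)
      show "(x has_vector_derivative A (x (t + s))) (at (t + s) within (\<lambda>s. t + s) ` {0..h})"
        using mem by (intro has_vector_derivative_within_subset[OF x[OF mem[OF that]]]) blast
    qed
    then show ?thesis by (simp add: X_def o_def)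
  qed
  have AX: "((\<lambda>s. A (X s)) has_vector_derivative A (A (X s))) (at s within {0..h})"
    if "s \<in> {0..h}" for s using A.has_vector_derivative[OF X[OF that]] .
  have AAX: "((\<lambda>s. A (A (X s))) has_vector_derivative A (A (A (X s)))) (at s within {0..h})"
    if "s \<in> {0..h}" for s using A.has_vector_derivative[OF AX[OF that]] .
  define g where "g = (\<lambda>s. X s - X 0 - (s/2) *\<^sub>R (A (X s) + A (X 0)))"
  define g' where "g' = (\<lambda>s. (1/2) *\<^sub>R (A (X s) - A (X 0)) - (s/2) *\<^sub>R A (A (X s)))"
  define g'' where "g'' = (\<lambda>s. - (s/2) *\<^sub>R A (A (A (X s))))"
  have half: "((\<lambda>s. s/2) has_field_derivative 1/2) (at s within {0..h})" for s :: real
    by (auto intro!: derivative_eq_intros)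
  have g: "(g has_vector_derivative g' s) (at s within {0..h})" if "s \<in> {0..h}" for s
  proof -
    have "(g has_vector_derivative (A (X s) - 0)
        - ((s/2) *\<^sub>R (A (A (X s)) + 0) + (1/2) *\<^sub>R (A (X s) + A (X 0)))) (at s within {0..h})"
      unfolding g_def
      by (intro has_vector_derivative_diff has_vector_derivative_scaleR has_vector_derivative_add
          has_vector_derivative_const X AX half that)
    moreover have "(A (X s) - 0) - ((s/2) *\<^sub>R (A (A (X s)) + 0) + (1/2) *\<^sub>R (A (X s) + A (X 0))) = g' s"
      using scaleR_left_distrib[of "1/2" "1/2" "A (X s)"]
      by (simp add: g'_def scaleR_add_right scaleR_diff_right algebra_simps)
    ultimately show ?thesis by simp
  qed
  have g1: "(g' has_vector_derivative g'' s) (at s within {0..h})" if "s \<in> {0..h}" for s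
  proof -
    have "(g' has_vector_derivative ((1/2) *\<^sub>R (A (A (X s)) - 0) + 0 *\<^sub>R (A (X s) - A (X 0)))
        - ((s/2) *\<^sub>R A (A (A (X s))) + (1/2) *\<^sub>R A (A (X s)))) (at s within {0..h})"
      unfolding g'_def
      by (intro has_vector_derivative_diff has_vector_derivative_scaleR
          has_vector_derivative_const DERIV_const AX AAX half that)
    then show ?thesis by (simp add: g''_def)
  qed
  have "norm (g'' s) \<le> b * h" if "s \<in> {0..h}" for s
  proof -
    have "norm (A (A (A (X s)))) \<le> b" using b[OF mem[OF that]] by (simp add: X_def)
    then have "s/2 * norm (A (A (A (X s)))) \<le> h * b"
      using that by (intro mult_mono) auto
    then show ?thesis using that by (simp add: g''_def mult.commute)
  qed
  then have "norm (g' s - g' 0) \<le> b * h * h" if "s \<in> {0..h}" for s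
    using norm_diff_le_of_derivative_bound[OF g1] that by blast
  then have "norm (g' s) \<le> b * h * h" if "s \<in> {0..h}" for s
    using that by (simp add: g'_def)
  then have "norm (g h - g 0) \<le> b * h * h * h"
    using norm_diff_le_of_derivative_bound[OF g] h by fastforce
  then show ?thesis
    by (simp add: g_def X_def A.add power3_eq_cube mult.assoc)
qed

text \<open>
  Discrete Gronwall estimate. The cruder \<open>n d (1 + q)\<^sup>n\<close> in place of the geometric sum
  \<open>d ((1 + q)\<^sup>n - 1) / q\<close> avoids the division by \<open>q\<close>, and is as good for \<open>n h \<le> T\<close>.
\<close>

lemma perturbed_growth_bound:
  fixes e :: "nat \<Rightarrow> real"
  assumes "e 0 \<le> 0" and "0 \<le> q" and "0 \<le> d"
    and step: "\<And>n. n < N \<Longrightarrow> e (Suc n) \<le> (1 + q) * e n + d"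
    and "n \<le> N"
  shows "e n \<le> real n * d * (1 + q) ^ n"
  using \<open>n \<le> N\<close>
proof (induction n)
  case 0
  then show ?case using assms(1) by simp
next
  case (Suc n)
  have "e (Suc n) \<le> (1 + q) * e n + d" using step Suc.prems by simp
  also have "\<dots> \<le> (1 + q) * (real n * d * (1 + q) ^ n) + d * (1 + q) ^ Suc n"
    using Suc assms(2,3) mult_left_mono[OF one_le_power[of "1 + q" "Suc n"], of d]
    by (intro add_mono mult_left_mono) auto
  also have "\<dots> = real (Suc n) * d * (1 + q) ^ Suc n" by (simp add: algebra_simps)
  finally show ?case .
qed

text \<open>
  The global error obeys the midpoint recursion of the iterates up to the defect \<open>\<tau>\<close>. Solving the
  implicit inequality for the new error costs the factor \<open>1 / (1 - z)\<close> with \<open>z = h a / 2\<close>; the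
  restriction \<open>h a \<le> 1\<close> gives \<open>z \<le> 1/2\<close>, which keeps this factor at most \<open>2\<close>.
\<close>

lemma midpoint_error_bound:
  fixes x :: "real \<Rightarrow> 'a::real_normed_vector" and xs :: "nat \<Rightarrow> 'a"
  assumes A: "bounded_linear A" and a: "\<And>y. norm (A y) \<le> a * norm y" "0 \<le> a"
    and x: "\<And>s. s \<in> {0..T} \<Longrightarrow> (x has_vector_derivative A (x s)) (at s within {0..T})"
    and b: "\<And>s. s \<in> {0..T} \<Longrightarrow> norm (A (A (A (x s)))) \<le> b" "0 \<le> b"
    and h: "0 < h" "h * a \<le> 1"
    and xs: "xs 0 = x 0" "\<And>n. xs (Suc n) - xs n = (h/2) *\<^sub>R A (xs (Suc n) + xs n)"
    and n: "real n * h \<le> T"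
  shows "norm (xs n - x (real n * h)) \<le> 2 * b * T * exp (2 * a * T) * h\<^sup>2"
proof -
  interpret A: bounded_linear A by (rule A)
  define e where "e = (\<lambda>n. xs n - x (real n * h))"
  have step: "norm (e (Suc k)) \<le> (1 + 2 * (h * a)) * norm (e k) + 2 * b * h ^ 3" if "k < n" for k
  proof -
    define \<tau> where "\<tau> = x (real k * h + h) - x (real k * h)
      - (h/2) *\<^sub>R A (x (real k * h + h) + x (real k * h))"
    have "real (Suc k) * h \<le> T"
      using that n h mult_right_mono[of "real (Suc k)" "real n" h] by linarith
    then have "real k * h + h \<le> T" by (simp add: algebra_simps)
    then have \<tau>: "norm \<tau> \<le> b * h ^ 3"
      unfolding \<tau>_def using h by (intro trapezoidal_defect[OF A x b(1)]) auto
    have Suc_k: "real (Suc k) * h = real k * h + h" by (simp add: algebra_simps)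
    have "e (Suc k) - e k = (xs (Suc k) - xs k) - (x (real k * h + h) - x (real k * h))"
      unfolding e_def Suc_k by simp
    also have "\<dots> = (h/2) *\<^sub>R A (e (Suc k) + e k) - \<tau>"
      unfolding xs(2) e_def \<tau>_def Suc_k by (simp add: A.add A.diff algebra_simps)
    finally have e_step: "e (Suc k) = (e k + (h/2) *\<^sub>R A (e (Suc k) + e k)) - \<tau>"
      by (simp only: algebra_simps diff_eq_eq)
    have "norm (e (Suc k)) \<le> norm (e k + (h/2) *\<^sub>R A (e (Suc k) + e k)) + norm \<tau>"
      by (subst e_step) (rule norm_triangle_ineq4)
    also have "\<dots> \<le> norm (e k) + norm ((h/2) *\<^sub>R A (e (Suc k) + e k)) + norm \<tau>"
      by (intro add_right_mono norm_triangle_ineq)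
    also have "norm ((h/2) *\<^sub>R A (e (Suc k) + e k)) \<le> h/2 * (a * (norm (e (Suc k)) + norm (e k)))"
      using h a(2) order_trans[OF a(1) mult_left_mono[OF norm_triangle_ineq a(2)]]
      by (simp add: mult_left_mono)
    finally have *: "norm (e (Suc k)) \<le>
        norm (e k) + h/2 * (a * (norm (e (Suc k)) + norm (e k))) + b * h ^ 3"
      using \<tau> by linarith
    define z where "z = h * a / 2"
    have z: "0 \<le> z" "z \<le> 1/2" using h a(2) by (auto simp: z_def)
    have 1: "(1 - z) * norm (e (Suc k)) \<le> (1 + z) * norm (e k) + b * h ^ 3"
      using * by (simp add: z_def algebra_simps)
    \<comment> \<open>For \<open>0 \<le> z \<le> 1/2\<close>, the amplification factor \<open>(1 + z) / (1 - z)\<close> is at most \<open>1 + 4 z\<close>.\<close>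
    have "z * z \<le> z * (1/2)" using z by (intro mult_left_mono) auto
    then have "(1 + z) \<le> (1 - z) * (1 + 4 * z)" by (simp add: algebra_simps)
    then have 2: "(1 + z) * norm (e k) \<le> (1 - z) * (1 + 4 * z) * norm (e k)"
      by (rule mult_right_mono) simp
    have "1 * (b * h ^ 3) \<le> ((1 - z) * 2) * (b * h ^ 3)"
      using z b(2) h(1) by (intro mult_right_mono) auto
    with 1 2 have "(1 - z) * norm (e (Suc k)) \<le> (1 - z) * ((1 + 4 * z) * norm (e k) + 2 * b * h ^ 3)"
      by (simp add: algebra_simps)
    then have "norm (e (Suc k)) \<le> (1 + 4 * z) * norm (e k) + 2 * b * h ^ 3"
      using z by (simp add: mult_le_cancel_left)
    then show ?thesis by (simp add: z_def mult.commute)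
  qed
  have nh: "0 \<le> real n * h" using h by simp
  then have T: "0 \<le> T" using n by simp
  have "norm (e n) \<le> real n * (2 * b * h ^ 3) * (1 + 2 * (h * a)) ^ n"
    by (rule perturbed_growth_bound[where e = "\<lambda>k. norm (e k)" and N = n])
       (use a b h xs(1) step in \<open>auto simp: e_def\<close>)
  also have "\<dots> = (real n * h) * (2 * b * h\<^sup>2 * (1 + 2 * (h * a)) ^ n)"
    by (simp add: power2_eq_square power3_eq_cube)
  also have "\<dots> \<le> T * (2 * b * h\<^sup>2 * exp (2 * a * T))"
  proof (intro mult_mono n order_refl)
    have "(1 + 2 * (h * a)) ^ n \<le> exp (2 * (h * a)) ^ n"
      using h a by (intro power_mono exp_ge_add_one_self) auto
    also have "\<dots> = exp (2 * a * (real n * h))"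
      by (simp add: exp_of_nat_mult[symmetric] algebra_simps)
    also have "\<dots> \<le> exp (2 * a * T)" using n a(2) by (simp add: mult_left_mono)
    finally show "(1 + 2 * (h * a)) ^ n \<le> exp (2 * a * T)" .
  qed (use b h a T in auto)
  finally show ?thesis by (simp add: e_def algebra_simps)
qed

section \<open>Reduction of the index-one system to an ordinary differential equation\<close>

text \<open>
  The set \<open>V\<close> consists of the consistent values: \<open>M x\<close> must lie in the range of \<open>E\<close> for the equation
  to be solvable for \<open>x'\<close>. An exact solution lies in \<open>V\<close> at every time, the initial time included;
  this is why the initial value of the iteration is consistent. That the derivative also obeys the
  constraint needs no separate argument: \<open>x = G E x\<close> on \<open>[0,T]\<close>, and differentiating the right-hand
  side gives \<open>G E x' = G M x\<close>.
\<close>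

lemma midpoint_order_2_of_no_hidden_constraint:
  fixes E M :: "real^'n^'n"
  assumes hidden: "\<And>v z. E *v v = 0 \<Longrightarrow> M *v v = E *v z \<Longrightarrow> v = 0"
  shows "midpoint_has_order 2 E M x0"
  unfolding midpoint_has_order_def
proof (intro allI impI)
  fix T :: real and x assume "T > 0" and sol: "dae_solution E M x0 T x"
  define V where "V = {v. M *v v \<in> range ((*v) E)}"
  have V: "subspace V"
  proof -
    have "V = (*v) M -` range ((*v) E)" by (auto simp: V_def)
    then show ?thesis
      by (simp add: linear_subspace_vimage linear_subspace_image)
  qed
  have "inj_on ((*v) E) V"
  proof (rule inj_onI)
    fix v v' assume "v \<in> V" "v' \<in> V" and eq: "E *v v = E *v v'"
    then have "v - v' \<in> V" using V subspace_diff by blast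
    then obtain z where "M *v (v - v') = E *v z" by (auto simp: V_def)
    with hidden[of "v - v'" z] eq show "v = v'" by (simp add: matrix_vector_mult_diff_distrib)
  qed
  then obtain G where "linear G" and G: "\<And>v. v \<in> V \<Longrightarrow> G (E *v v) = v"
    using linear_exists_left_inverse_on[OF matrix_vector_mul_linear V] by metis
  define A where "A = (\<lambda>v. G (M *v v))"
  have bG: "bounded_linear G" using \<open>linear G\<close> by (simp add: linear_conv_bounded_linear)
  have A: "bounded_linear A"
    unfolding A_def by (rule bounded_linear_compose[OF bG matrix_vector_mul_bounded_linear])
  have deriv: "\<exists>x'. (x has_vector_derivative x') (at t within {0..T}) \<and> E *v x' = M *v x t"
    if "t \<in> {0..T}" for t
    using sol[unfolded dae_solution_def, THEN conjunct2] that by (rule bspec)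
  have xV: "x t \<in> V" if t: "t \<in> {0..T}" for t
  proof -
    obtain x' where "E *v x' = M *v x t" using deriv[OF t] by blast
    then have "M *v x t = E *v x'" ..
    then show ?thesis by (auto simp: V_def)
  qed
  have ode: "(x has_vector_derivative A (x t)) (at t within {0..T})" if t: "t \<in> {0..T}" for t
  proof -
    obtain x' where x': "(x has_vector_derivative x') (at t within {0..T})" "E *v x' = M *v x t"
      using deriv[OF t] by blast
    have "bounded_linear (\<lambda>v. G (E *v v))"
      by (rule bounded_linear_compose[OF bG matrix_vector_mul_bounded_linear])
    then have "((\<lambda>s. G (E *v x s)) has_vector_derivative G (E *v x')) (at t within {0..T})"
      using x'(1) by (rule bounded_linear.has_vector_derivative)
    then have "((\<lambda>s. G (E *v x s)) has_vector_derivative A (x t)) (at t within {0..T})"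
      by (simp add: x'(2) A_def)
    then show ?thesis
      by (rule has_vector_derivative_transform[OF t, rotated]) (simp add: G xV)
  qed
  obtain a where a: "\<And>y. norm (A y) \<le> a * norm y" "0 \<le> a"
    using bounded_linear.nonneg_bounded[OF A] by (metis mult.commute)
  have "continuous_on {0..T} x"
    using ode has_vector_derivative_continuous by (metis continuous_on_eq_continuous_within)
  then have "continuous_on {0..T} (\<lambda>t. A (A (A (x t))))"
    by (intro bounded_linear.continuous_on[OF A])
  then have "bounded ((\<lambda>t. A (A (A (x t)))) ` {0..T})"
    by (intro compact_imp_bounded compact_continuous_image) auto
  then obtain b where b: "\<And>t. t \<in> {0..T} \<Longrightarrow> norm (A (A (A (x t)))) \<le> b"
    unfolding bounded_iff by blast
  have "0 \<le> b" using order_trans[OF norm_ge_zero b[of 0]] \<open>T > 0\<close> by simp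
  have bound: "norm (xs n - x (real n * h)) \<le> 2 * b * T * exp (2 * a * T) * h\<^sup>2"
    if h: "0 < h" "h * a \<le> 1" and "xs 0 = x0"
      and step: "\<And>n. midpoint_step E M h (xs n) (xs (Suc n))" and n: "real n * h \<le> T"
    for h n and xs :: "nat \<Rightarrow> real^'n"
  proof -
    have x0: "x 0 = x0" using sol by (simp add: dae_solution_def)
    have E_step: "E *v (xs (Suc n) - xs n) = (h/2) *\<^sub>R (M *v (xs (Suc n) + xs n))" for n
      using step h(1) midpoint_step_increment[of h E M] by simp
    \<comment> \<open>The step equation puts \<open>xs (Suc n) + xs n\<close> into \<open>V\<close>, so consistency passes from
        \<open>xs n\<close> to \<open>xs (Suc n)\<close>.\<close>
    have xsV: "xs n \<in> V" for n
    proof (induction n)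
      case 0
      then show ?case using xV[of 0] x0 \<open>xs 0 = x0\<close> \<open>T > 0\<close> by simp
    next
      case (Suc n)
      have "M *v (xs (Suc n) + xs n) = E *v ((2/h) *\<^sub>R (xs (Suc n) - xs n))"
        unfolding matrix_vector_mult_scaleR E_step using h by simp
      then have "xs (Suc n) + xs n \<in> V" by (auto simp: V_def)
      then show ?case using subspace_diff[OF V _ Suc, of "xs (Suc n) + xs n"] by simp
    qed
    have "xs (Suc n) - xs n = (h/2) *\<^sub>R A (xs (Suc n) + xs n)" for n
    proof -
      have "xs (Suc n) - xs n = G (E *v (xs (Suc n) - xs n))"
        using G subspace_diff[OF V xsV xsV] by simp
      then show ?thesis unfolding E_step A_def by (simp add: linear_cmul[OF \<open>linear G\<close>])
    qed
    then show ?thesis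
      using midpoint_error_bound[OF A a ode b \<open>0 \<le> b\<close> h _ _ n, of xs] \<open>xs 0 = x0\<close> x0 by simp
  qed
  have "\<forall>\<^sub>F h in at_right (0::real). 0 < h \<and> h * a \<le> 1"
    unfolding eventually_at_right_field
  \<comment> \<open>The \<open>+ 1\<close> covers \<open>a = 0\<close>.\<close>
  proof (intro exI[of _ "1 / (a + 1)"] conjI allI impI)
    show "0 < 1 / (a + 1)" using a(2) by simp
    fix h :: real assume h: "0 < h" "h < 1 / (a + 1)"
    then have "h * (a + 1) < 1" using a(2) by (simp add: field_simps)
    then show "h * a \<le> 1" using h by (simp add: algebra_simps)
  qed
  then show "\<exists>C. \<forall>\<^sub>F h in at_right 0. \<forall>xs :: nat \<Rightarrow> real^'n.
      xs 0 = x0 \<and> (\<forall>n. midpoint_step E M h (xs n) (xs (Suc n))) \<longrightarrow>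
      (\<forall>n. real n * h \<le> T \<longrightarrow> norm (xs n - x (real n * h)) \<le> C * h\<^sup>2)"
    by (intro exI[of _ "2 * b * T * exp (2 * a * T)"]) (auto elim!: eventually_mono intro: bound)
qed

section \<open>Energy conservation and the two cases\<close>

text \<open>
  By symmetry of \<open>E\<close>, \<open>(y + x) \<bullet> E (y - x)\<close> is twice the energy increment; the right-hand side of the
  step equation contributes the quadratic form of \<open>J\<close> at \<open>y + x\<close>, which is zero.
\<close>

lemma midpoint_preserves_hamiltonian:
  fixes E J :: "real^'n^'n"
  assumes E: "transpose E = E" and J: "transpose J = - J"
    and step: "midpoint_step E J h x y" and h: "h \<noteq> 0"
  shows "hamiltonian E y = hamiltonian E x"
proof -
  have "(1/h) * ((y + x) \<bullet> (E *v (y - x))) = (1/2) * ((y + x) \<bullet> (J *v (y + x)))"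
    using arg_cong[OF step[unfolded midpoint_step_def], of "\<lambda>z. (y + x) \<bullet> z"] by simp
  then have "(y + x) \<bullet> (E *v (y - x)) = 0"
    using h by (simp add: inner_skew_eq_0[OF J])
  moreover have "x \<bullet> (E *v y) = y \<bullet> (E *v x)"
    using inner_matrix_vector_transpose[of x E y] by (simp add: E inner_commute)
  ultimately show ?thesis
    by (simp add: hamiltonian_def matrix_vector_mult_diff_distrib inner_diff_right inner_add_left)
qed

lemma regularized_form:
  fixes E K :: "real^'n^'n"
  shows "x \<bullet> ((E + transpose K ** K) *v x) = x \<bullet> (E *v x) + (K *v x) \<bullet> (K *v x)"
proof -
  have "x \<bullet> (transpose K *v (K *v x)) = (K *v x) \<bullet> (K *v x)"
    by (metis inner_matrix_vector_transpose transpose_transpose)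
  then show ?thesis
    by (simp only: matrix_vector_mult_add_rdistrib inner_add_right matrix_vector_mul_assoc)
qed

lemma regularized_psd:
  fixes E K :: "real^'n^'n"
  assumes "sym_pos_semidef E"
  shows "sym_pos_semidef (E + transpose K ** K)"
proof -
  have "transpose (E + transpose K ** K) = transpose E + transpose (transpose K ** K)"
    by (simp add: transpose_def vec_eq_iff)
  also have "\<dots> = E + transpose K ** K"
    using assms by (simp add: sym_pos_semidef_def matrix_transpose_mul)
  finally have "transpose (E + transpose K ** K) = E + transpose K ** K" .
  then show ?thesis using assms by (simp add: sym_pos_semidef_def regularized_form)
qed

text \<open>
  Both summands of the quadratic form vanish, so \<open>x\<close> lies in the kernel of \<open>E\<close> and \<open>K x = 0\<close>. But
  \<open>K\<close> fixes every vector of that kernel.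
\<close>

lemma regularized_trivial_null:
  fixes E K :: "real^'n^'n"
  assumes E: "sym_pos_semidef E" and K: "projector_onto K (null_space E)"
    and 0: "(E + transpose K ** K) *v x = 0"
  shows "x = 0"
proof -
  have "x \<bullet> (E *v x) + (K *v x) \<bullet> (K *v x) = x \<bullet> ((E + transpose K ** K) *v x)"
    by (rule regularized_form[symmetric])
  moreover have "0 \<le> x \<bullet> (E *v x)" using E by (simp add: sym_pos_semidef_def)
  moreover have "0 \<le> (K *v x) \<bullet> (K *v x)" by (rule inner_ge_zero)
  ultimately have "x \<bullet> (E *v x) = 0" and Kx: "(K *v x) \<bullet> (K *v x) = 0"
    unfolding 0 inner_zero_right by linarith+
  then have "x \<in> null_space E" using psd_null_if_form_0[OF E] by (simp add: null_space_def)
  then obtain v where "x = K *v v" using K by (auto simp: projector_onto_def)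
  moreover from this have "K *v x = x"
    using K by (simp add: projector_onto_def matrix_vector_mul_assoc)
  ultimately show ?thesis using Kx by simp
qed

text \<open>
  Since \<open>K\<^sup>T E = 0\<close> and \<open>K\<^sup>T J = 0\<close>, multiplying the step equation by \<open>K\<^sup>T\<close> leaves
  \<open>K\<^sup>T K (y - x) = 0\<close>; here \<open>K\<^sup>T K\<^sup>T = K\<^sup>T\<close> holds for an oblique projector as well. This is the reason
  why the original energy, and not only the regularized one, is conserved.
\<close>

lemma regularized_step_is_step:
  fixes E J K :: "real^'n^'n"
  assumes E: "transpose E = E" and K: "projector_onto K (null_space E)"
    and KJ: "transpose K ** J = 0"
    and step: "midpoint_step (E + transpose K ** K) J h x y" and h: "h \<noteq> 0"
  shows "midpoint_step E J h x y"
proof -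
  define d where "d = y - x"
  have "E *v (K *v z) = 0" for z using K by (auto simp: projector_onto_def null_space_def)
  then have "E ** K = 0" by (simp add: matrix_eq matrix_vector_mul_assoc[symmetric])
  then have KE: "transpose K ** E = 0"
    using E transpose_mult_eq_0[of E K] by simp
  have KK: "transpose K ** transpose K = transpose K"
    using K by (metis matrix_transpose_mul projector_onto_def)
  have eq: "(1/h) *\<^sub>R (E *v d + transpose K *v (K *v d)) = (1/2) *\<^sub>R (J *v (y + x))"
    using step by (simp add: midpoint_step_def d_def matrix_vector_mult_add_rdistrib
        matrix_vector_mul_assoc[symmetric])
  have "(1/h) *\<^sub>R (transpose K *v (K *v d)) = 0"
    using arg_cong[OF eq, of "\<lambda>z. transpose K *v z"] KE KK KJ
    by (simp add: matrix_vector_mult_scaleR matrix_vector_right_distrib matrix_vector_mul_assoc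
        matrix_mul_assoc)
  then show ?thesis using eq h by (simp add: midpoint_step_def d_def)
qed

theorem lemma4p7:
  fixes E J R K Ehat :: "real^'n^'n"
    and B :: "real^'m^'n"
    and u :: "real \<Rightarrow> real^'m"
    and x0 :: "real^'n"
  assumes E: "sym_pos_semidef E"
    and J: "transpose J = - J"
    and R: "sym_pos_semidef R"
    and regular: "regular_pencil E (J - R)"
    and index: "differentiation_index E (J - R) (\<lambda>t. B *v u t) \<le> 1"
    and K: "projector_onto K (null_space E)"
    and cases: "case_a E J R B K \<and> Ehat = E \<or>
                case_b E J R K \<and> Ehat = E + transpose K ** K"
  shows "(case_a E J R B K \<and> Ehat = E \<longrightarrow> differentiation_index Ehat J (\<lambda>t. 0) \<le> 1) \<and>
    (case_b E J R K \<and> Ehat = E + transpose K ** K \<longrightarrow> invertible Ehat) \<and>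
    (\<forall>h. h \<noteq> 0 \<longrightarrow>
       invertible (Ehat + (h/2) *\<^sub>R J) \<and> invertible (Ehat - (h/2) *\<^sub>R J) \<and>
       (\<forall>x. \<exists>!y. midpoint_step Ehat J h x y)) \<and>
    midpoint_has_order 2 Ehat J x0 \<and>
    (\<forall>h x y. h \<noteq> 0 \<and> midpoint_step Ehat J h x y \<longrightarrow> hamiltonian E y = hamiltonian E x)"
proof -
  \<comment> \<open>By symmetry of \<open>R\<close>, \<open>K\<^sup>T R = 0\<close> means \<open>R K = 0\<close>: dissipation is invisible on the kernel of \<open>E\<close>,
      which is the only place where the index condition looks at the second matrix.\<close>
  have hidden_a: "v = 0"
    if "case_a E J R B K" and v: "E *v v = 0" and z: "J *v v = E *v z" for v z
  proof -
    have "transpose K ** R = 0" using that(1) by (simp add: case_a_def)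
    then have RK: "R ** K = 0"
      using R transpose_mult_eq_0[of K R] by (simp add: sym_pos_semidef_def)
    obtain c where "v = K *v c" using v K by (auto simp: projector_onto_def null_space_def)
    then have "R *v v = 0" by (simp add: matrix_vector_mul_assoc RK)
    then have "(J - R) *v v = E *v z" using z by (simp add: matrix_vector_mult_diff_rdistrib)
    then show ?thesis
      by (rule index_le_1_imp_no_hidden_constraint[OF index
            dissipative_pencil_invertible[OF E J R regular] v])
  qed
  have trivial_b: "v = 0" if "Ehat = E + transpose K ** K" and "Ehat *v v = 0" for v
    using regularized_trivial_null[OF E K] that by simp
  have hidden: "v = 0" if "Ehat *v v = 0" "J *v v = Ehat *v z" for v z
    using cases hidden_a trivial_b that by blast
  have Ehat: "sym_pos_semidef Ehat" using cases E regularized_psd[OF E] by auto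
  have reg: "regular_pencil Ehat J"
    using cases trivial_b by (auto simp: regular_pencil_def null_space_def case_a_def)
  have inv: "invertible (Ehat + (h/2) *\<^sub>R J)" "invertible (Ehat - (h/2) *\<^sub>R J)" if "h \<noteq> 0" for h
    using psd_plus_skew_invertible[OF Ehat J reg, of "h/2"]
      psd_plus_skew_invertible[OF Ehat J reg, of "- (h/2)"] that by auto
  have "\<exists>!y. midpoint_step Ehat J h x y" if "h \<noteq> 0" for h x
    using ex1_matrix_vector_eq[OF inv(2)[OF that]] by (simp add: midpoint_step_iff that)
  moreover have "hamiltonian E y = hamiltonian E x"
    if h: "h \<noteq> 0" and step: "midpoint_step Ehat J h x y" for h x y
  proof -
    have E_sym: "transpose E = E" using E by (simp add: sym_pos_semidef_def)
    have "midpoint_step E J h x y"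
      using cases step regularized_step_is_step[OF E_sym K _ _ h] by (auto simp: case_b_def)
    then show ?thesis by (rule midpoint_preserves_hamiltonian[OF E_sym J _ h])
  qed
  moreover have "differentiation_index Ehat J (\<lambda>t. 0) \<le> 1"
    by (rule no_hidden_constraint_imp_index_le_1) (rule hidden)
  moreover have "invertible Ehat" if "Ehat = E + transpose K ** K"
    using trivial_b[OF that] by (rule invertible_if_trivial_null)
  moreover have "midpoint_has_order 2 Ehat J x0"
    by (rule midpoint_order_2_of_no_hidden_constraint) (rule hidden)
  ultimately show ?thesis using inv by blast
qed

end
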